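(* Define integer sequences $(a_n),(b_n),(c_n),(d_n)$, $n\ge 0$, by the formal power series expansions \[ \frac{1-3x+9x^2}{1-2x-2x^2+x^3}=\sum_{n\ge0}a_nx^n,\quad \frac{2+6x-12x^2}{1-2x-2x^2+x^3}=\sum_{n\ge0}b_nx^n, \] \[ \frac{2+8x-10x^2}{1-2x-2x^2+x^3}=\sum_{n\ge0}c_nx^n,\quad \frac{1-11x+x^2}{1-2x-2x^2+x^3}=\sum_{n\ge0}d_nx^n. \] Then for all $n\ge 0$, $a_n^3+b_n^3=c_n^3+d_n^3$. *)

theory Defs
  imports "HOL-Computational_Algebra.Formal_Power_Series"
begin

text \<open>
  The type \<open>int fps\<close> carries no division in the library, so the power series identities are
  stated over the rationals, for sequences of integers embedded coefficientwise.
\<close>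

definition int_gen_fun :: "(nat \<Rightarrow> int) \<Rightarrow> rat fps" where
  "int_gen_fun s = Abs_fps (\<lambda>n. of_int (s n))"

text \<open>
  The quotients below do have integer coefficients: for integers \<open>p\<close>, \<open>q\<close>, \<open>r\<close> exactly one
  integer sequence has the given rational function as its generating function.
\<close>

fun cubic_rec :: "int \<Rightarrow> int \<Rightarrow> int \<Rightarrow> nat \<Rightarrow> int" where
  "cubic_rec p q r 0 = p"
| "cubic_rec p q r (Suc 0) = q + 2 * p"
| "cubic_rec p q r (Suc (Suc 0)) = r + 2 * cubic_rec p q r (Suc 0) + 2 * p"
| "cubic_rec p q r (Suc (Suc (Suc n))) =
     2 * cubic_rec p q r (Suc (Suc n)) + 2 * cubic_rec p q r (Suc n) - cubic_rec p q r n"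

lemma ex1_int_gen_fun:
  "\<exists>!s. int_gen_fun s =
     (of_int p + of_int q * fps_X + of_int r * fps_X ^ 2) / (1 - 2 * fps_X - 2 * fps_X ^ 2 + fps_X ^ 3)"
proof (rule ex1I)
  let ?N = "of_int p + of_int q * fps_X + of_int r * fps_X ^ 2 :: rat fps"
  define S where "S = int_gen_fun (cubic_rec p q r)"
  define D :: "rat fps" where "D = 1 - 2 * fps_X - 2 * fps_X ^ 2 + fps_X ^ 3"
  have nth: "fps_nth S k = of_int (cubic_rec p q r k)" for k
    by (simp add: S_def int_gen_fun_def)
  have eq: "S * D = S - fps_const 2 * (fps_X ^ 1 * S) - fps_const 2 * (fps_X ^ 2 * S) + fps_X ^ 3 * S"
    unfolding D_def numeral_fps_const[symmetric] by (simp add: algebra_simps)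
  have N: "?N = fps_const (of_int p) + fps_const (of_int q) * fps_X ^ 1 + fps_const (of_int r) * fps_X ^ 2"
    by (simp add: fps_of_int)
  have "fps_nth (S * D) n = fps_nth ?N n" for n
  proof -
    consider "n = 0" | "n = 1" | "n = 2" | "n \<ge> 3"
      by linarith
    then show ?thesis
    proof cases
      case 4
      then obtain m where "n = Suc (Suc (Suc m))"
        by (metis le_Suc_ex numeral_3_eq_3 add_Suc add_0)
      then show ?thesis
        unfolding eq N fps_add_nth fps_sub_nth fps_mult_left_const_nth fps_X_power_mult_nth fps_X_power_nth nth
        by (simp add: numeral_2_eq_2 numeral_3_eq_3)
    qed (simp_all only: eq N fps_add_nth fps_sub_nth fps_mult_left_const_nth fps_X_power_mult_nth
        fps_X_power_nth nth fps_nth_fps_const, simp_all add: numeral_2_eq_2)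
  qed
  then have *: "S * D = ?N"
    unfolding fps_eq_iff by blast
  have "fps_nth D 0 = 1"
    unfolding D_def numeral_fps_const by simp
  then have "D \<noteq> 0"
    by auto
  then have S: "S = ?N / D"
    unfolding *[symmetric] by (rule nonzero_mult_div_cancel_right[symmetric])
  then show "int_gen_fun (cubic_rec p q r) =
      ?N / (1 - 2 * fps_X - 2 * fps_X ^ 2 + fps_X ^ 3)"
    unfolding S_def D_def .
  fix s assume "int_gen_fun s = ?N / (1 - 2 * fps_X - 2 * fps_X ^ 2 + fps_X ^ 3)"
  then have "int_gen_fun s = S"
    unfolding S D_def .
  then have "fps_nth (int_gen_fun s) k = fps_nth S k" for k
    by (rule arg_cong)
  then show "s = cubic_rec p q r"
    unfolding nth by (simp add: int_gen_fun_def fun_eq_iff)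
qed

end

theory Submission
  imports Defs "HOL-Number_Theory.Fib"
begin

text \<open>
  Since \<open>1 - 2x - 2x\<^sup>2 + x\<^sup>3 = (1 + x) (1 - 3x + x\<^sup>2)\<close>, partial fractions express each coefficient in
  terms of \<open>e = (-1)\<^sup>n\<close> and the Fibonacci numbers \<open>F\<^bsub>2n\<^esub>\<close>, \<open>F\<^bsub>2n+1\<^esub>\<close>. Modulo \<open>e\<^sup>2 = 1\<close> and Cassini's identity,
  the claim becomes a polynomial identity.
\<close>

text \<open>The characteristic polynomial factors as \<open>(t + 1) * (t^2 - 3 * t + 1)\<close>;
  \<open>(- 1) ^ n\<close> is annihilated by the first factor, both Fibonacci terms by the second.
  The coefficients fit the three initial values.\<close>

lemma cubic_rec_fib:
  "5 * cubic_rec p q r n = (p - q + r) * (- 1) ^ n + (3 * p + 2 * q + 3 * r) * int (fib (2 * n))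
     + (4 * p + q - r) * int (fib (Suc (2 * n)))"
  by (induction p q r n rule: cubic_rec.induct) (simp_all add: algebra_simps)

text \<open>Clearing the denominator and comparing coefficients yields the defining equations of
  \<open>cubic_rec\<close>.\<close>

lemma int_gen_fun_eqD:
  assumes "(of_int p + of_int q * fps_X + of_int r * fps_X ^ 2) /
      (1 - 2 * fps_X - 2 * fps_X ^ 2 + fps_X ^ 3) = int_gen_fun s"
  shows "s = cubic_rec p q r"
proof
  fix n
  define S where "S = int_gen_fun s"
  define D :: "rat fps" where "D = 1 - 2 * fps_X - 2 * fps_X ^ 2 + fps_X ^ 3"
  have nth: "fps_nth S k = of_int (s k)" for k
    by (simp add: S_def int_gen_fun_def)
  have "fps_nth D 0 \<noteq> 0"
    unfolding D_def numeral_fps_const by simp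
  then have "S * D = of_int p + of_int q * fps_X + of_int r * fps_X ^ 2"
    unfolding S_def assms[symmetric] D_def[symmetric]
    by (simp add: fps_divide_unit mult.assoc inverse_mult_eq_1)
  moreover have "S * D = S - fps_const 2 * (fps_X ^ 1 * S) - fps_const 2 * (fps_X ^ 2 * S) + fps_X ^ 3 * S"
    unfolding D_def numeral_fps_const[symmetric] by (simp add: algebra_simps)
  ultimately have eq: "S - fps_const 2 * (fps_X ^ 1 * S) - fps_const 2 * (fps_X ^ 2 * S) + fps_X ^ 3 * S =
      fps_const (of_int p) + fps_const (of_int q) * fps_X ^ 1 + fps_const (of_int r) * fps_X ^ 2"
    by (simp add: fps_of_int)
  \<comment> \<open>The guards make terms of negative index vanish, where truncated subtraction
    would give \<open>s 0\<close>.\<close>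
  have coeff: "s k - (if k < 1 then 0 else 2 * s (k - 1)) - (if k < 2 then 0 else 2 * s (k - 2))
      + (if k < 3 then 0 else s (k - 3)) =
      (if k = 0 then p else 0) + (if k = 1 then q else 0) + (if k = 2 then r else 0)" for k
  proof -
    have k: "k = 0 \<or> k = 1 \<or> k = 2 \<or> k \<ge> 3"
      by linarith
    have "of_int (s k - (if k < 1 then 0 else 2 * s (k - 1)) - (if k < 2 then 0 else 2 * s (k - 2))
      + (if k < 3 then 0 else s (k - 3))) =
      (of_int ((if k = 0 then p else 0) + (if k = 1 then q else 0) + (if k = 2 then r else 0)) :: rat)"
      using arg_cong[OF eq, of "\<lambda>f. fps_nth f k"]
      unfolding fps_add_nth fps_sub_nth fps_mult_left_const_nth fps_X_power_mult_nth
        fps_X_power_nth fps_nth_fps_const nth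
      using k by (elim disjE) simp_all
    then show ?thesis
      unfolding of_int_eq_iff .
  qed
  have s: "s 0 = p" "s (Suc 0) = q + 2 * s 0" "s (Suc (Suc 0)) = r + 2 * s (Suc 0) + 2 * s 0"
    using coeff[of 0] coeff[of "Suc 0"] coeff[of "Suc (Suc 0)"] by simp_all
  have s_rec: "s (Suc (Suc (Suc m))) = 2 * s (Suc (Suc m)) + 2 * s (Suc m) - s m" for m
    using coeff[of "Suc (Suc (Suc m))"] by (simp add: numeral_2_eq_2 numeral_3_eq_3)
  show "s n = cubic_rec p q r n"
    using s s_rec by (induction p q r n rule: cubic_rec.induct) simp_all
qed

theorem theorem2p3:
  fixes a b c d :: "nat \<Rightarrow> int"
  assumes "(1 - 3 * fps_X + 9 * fps_X ^ 2) / (1 - 2 * fps_X - 2 * fps_X ^ 2 + fps_X ^ 3) = int_gen_fun a"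
    and "(2 + 6 * fps_X - 12 * fps_X ^ 2) / (1 - 2 * fps_X - 2 * fps_X ^ 2 + fps_X ^ 3) = int_gen_fun b"
    and "(2 + 8 * fps_X - 10 * fps_X ^ 2) / (1 - 2 * fps_X - 2 * fps_X ^ 2 + fps_X ^ 3) = int_gen_fun c"
    and "(1 - 11 * fps_X + fps_X ^ 2) / (1 - 2 * fps_X - 2 * fps_X ^ 2 + fps_X ^ 3) = int_gen_fun d"
  shows "\<forall>n. a n ^ 3 + b n ^ 3 = c n ^ 3 + d n ^ 3"
proof
  fix n
  define e x y where "e = (- 1 :: int) ^ n" and "x = int (fib (2 * n))" and "y = int (fib (Suc (2 * n)))"
  have e: "e ^ 2 = 1"
    by (simp add: e_def flip: power_mult)
  \<comment> \<open>The index \<open>2 * n\<close> is even, which fixes the sign; the next Fibonacci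
    number is \<open>x + y\<close>.\<close>
  have cassini: "y ^ 2 - x * y - x ^ 2 = 1"
    using fib_Cassini_int[of "2 * n"] by (simp add: x_def y_def power2_eq_square algebra_simps)
  have "a = cubic_rec 1 (- 3) 9" "b = cubic_rec 2 6 (- 12)" "c = cubic_rec 2 8 (- 10)" "d = cubic_rec 1 (- 11) 1"
    using assms by (auto intro!: int_gen_fun_eqD)
  then have *: "5 * a n = 13 * e + 24 * x - 8 * y" "5 * b n = - 16 * e - 18 * x + 26 * y"
    "5 * c n = - 16 * e - 8 * x + 26 * y" "5 * d n = 13 * e - 16 * x - 8 * y"
    by (simp_all add: cubic_rec_fib e_def x_def y_def)
  \<comment> \<open>Left side minus right side equals
    \<open>12600 * x * (e^2 - (y^2 - x * y - x^2))\<close>, and both terms in the bracket are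
    1.\<close>
  have "(5 * a n) ^ 3 + (5 * b n) ^ 3 = (5 * c n) ^ 3 + (5 * d n) ^ 3"
    unfolding * using e cassini by algebra
  then show "a n ^ 3 + b n ^ 3 = c n ^ 3 + d n ^ 3"
    by (simp add: power_mult_distrib)
qed

end
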